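(* Let $k\ge 2$ be a fixed integer. For every function $\omega(n)$ with $\omega(n)\to\infty$ as $n\to\infty$, for all sufficiently large $n$, $$\frac{1}{\omega(n)}2^{-n/3}n^{-k}\le p_c(Q_{n,k},3)\le \omega(n)2^{-n/3}n^{-k}.$$
   Context: $Q_{n,k}$ is the graph with vertex set $\{0,1\}^n$ in which $x,y$ are adjacent iff $1\le d_H(x,y)\le k$ ($d_H$ = Hamming distance). The $r$-neighbor bootstrap percolation process from $\mathcal{A}_0\subset V$: $\mathcal{A}_i=\mathcal{A}_{i-1}\cup\{v: |N_v\cap\mathcal{A}_{i-1}|\ge r\}$, where $N_v$ is the neighborhood of $v$; it percolates if $\mathcal{A}_i=V$ for some $i$. In the random setting each vertex is placed in $\mathcal{A}_0$ independently with probability $p$, and $p_c(G,r)=\sup\{p\in(0,1): \mathbb{P}_p(\mathcal{A}_0 \text{ percolates on } G)\le 1/2\}$. $\omega(n)$ is an arbitrarily slowly growing function tending to infinity. *)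

theory Defs
  imports "HOL-Probability.Probability"
begin

text \<open>A graph is given by its vertex set \<open>V\<close> and its adjacency relation \<open>E\<close>. Vertex sets are
  assumed to be finite throughout: for infinite \<open>V\<close>, \<^const>\<open>card\<close> and \<^const>\<open>Pi_pmf\<close> below
  do not have their intended meaning.\<close>

definition neighborhood :: "'a set \<Rightarrow> ('a \<Rightarrow> 'a \<Rightarrow> bool) \<Rightarrow> 'a \<Rightarrow> 'a set" where
  "neighborhood V E v = {w \<in> V. E v w}"

primrec bootstrap :: "'a set \<Rightarrow> ('a \<Rightarrow> 'a \<Rightarrow> bool) \<Rightarrow> nat \<Rightarrow> 'a set \<Rightarrow> nat \<Rightarrow> 'a set" where
  "bootstrap V E r A 0 = A"
| "bootstrap V E r A (Suc i) =
     bootstrap V E r A i \<union> {v \<in> V. card (neighborhood V E v \<inter> bootstrap V E r A i) \<ge> r}"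

definition percolates :: "'a set \<Rightarrow> ('a \<Rightarrow> 'a \<Rightarrow> bool) \<Rightarrow> nat \<Rightarrow> 'a set \<Rightarrow> bool" where
  "percolates V E r A \<longleftrightarrow> (\<exists>i. bootstrap V E r A i = V)"

text \<open>The initial set is encoded by its indicator function \<open>f\<close>, whose values on \<open>V\<close> are independent
  Bernoulli variables; the second argument of \<^const>\<open>Pi_pmf\<close> is the irrelevant value outside \<open>V\<close>.\<close>

definition percolation_prob :: "'a set \<Rightarrow> ('a \<Rightarrow> 'a \<Rightarrow> bool) \<Rightarrow> nat \<Rightarrow> real \<Rightarrow> real" where
  "percolation_prob V E r p =
     measure_pmf.prob (Pi_pmf V False (\<lambda>_. bernoulli_pmf p)) {f. percolates V E r {v \<in> V. f v}}"

definition critical_prob :: "'a set \<Rightarrow> ('a \<Rightarrow> 'a \<Rightarrow> bool) \<Rightarrow> nat \<Rightarrow> real" where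
  "critical_prob V E r = Sup {p \<in> {0<..<1}. percolation_prob V E r p \<le> 1 / 2}"

definition cube_verts :: "nat \<Rightarrow> (nat \<Rightarrow> nat) set" where
  "cube_verts n = {..<n} \<rightarrow>\<^sub>E {0, 1}"

definition hamming_dist :: "nat \<Rightarrow> (nat \<Rightarrow> nat) \<Rightarrow> (nat \<Rightarrow> nat) \<Rightarrow> nat" where
  "hamming_dist n x y = card {i \<in> {..<n}. x i \<noteq> y i}"

definition cube_adj :: "nat \<Rightarrow> nat \<Rightarrow> (nat \<Rightarrow> nat) \<Rightarrow> (nat \<Rightarrow> nat) \<Rightarrow> bool" where
  "cube_adj n k x y \<longleftrightarrow> 1 \<le> hamming_dist n x y \<and> hamming_dist n x y \<le> k"

end

theory Submission
  imports Defs "HOL-Real_Asymp.Real_Asymp"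
begin

text \<open>Lower bound: percolation needs a vertex with three initially infected neighbours, and a union
  bound over the at most \<open>2^n * (n^k)^3\<close> such configurations applies.

  Upper bound: if \<open>v\<close> is at distance \<open>k\<close> from three infected vertices that differ from \<open>v\<close> on
  disjoint sets \<open>S1\<close>, \<open>S2\<close>, \<open>S3\<close> of coordinates, then the infection reaches \<open>v\<close>, then \<open>v\<close> with one
  coordinate of \<open>S1\<close> and one of \<open>S2\<close> flipped, then all neighbours of \<open>v\<close> in the hypercube, and from
  there everything. Taking each \<open>S\<close> from its own third of the coordinates still leaves of the order
  of \<open>2^n * n^(3 k)\<close> triples, so the second moment method yields an infected one with probability
  above \<open>1/2\<close> once \<open>p\<close> is a large constant times \<open>2^(-n/3) * n^(-k)\<close>. The resulting bound on the
  failure probability decreases in \<open>p\<close>, so no coupling of different densities is needed.\<close>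

section \<open>Bootstrap percolation\<close>

lemma bootstrap_mono:
  assumes "i \<le> j" shows "bootstrap V E r A i \<subseteq> bootstrap V E r A j"
  using assms by (induction rule: dec_induct) auto

lemma bootstrap_subset:
  assumes "A \<subseteq> V" shows "bootstrap V E r A i \<subseteq> V"
  using assms by (induction i) auto

text \<open>If no two consecutive stages agreed, every step would add a vertex, so stage
  \<open>i\<close> would have at least \<open>i\<close> elements; this fails at stage
  \<open>card V + 1\<close>.\<close>

lemma bootstrap_eventually_closed:
  assumes "finite V" "A \<subseteq> V"
  obtains i where "bootstrap V E r A (Suc i) = bootstrap V E r A i"
proof -
  have "\<exists>i. bootstrap V E r A (Suc i) = bootstrap V E r A i"
  proof (rule ccontr)
    assume neq: "\<nexists>i. bootstrap V E r A (Suc i) = bootstrap V E r A i"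
    have fin: "finite (bootstrap V E r A i)" for i
      using bootstrap_subset[OF assms(2)] assms(1) finite_subset by metis
    have "card (bootstrap V E r A i) \<ge> i" for i
    proof (induction i)
      case (Suc i)
      have "bootstrap V E r A i \<subset> bootstrap V E r A (Suc i)"
        using neq bootstrap_mono[of i "Suc i" V E r A] by (metis le_SucI order_refl psubsetI)
      then have "card (bootstrap V E r A i) < card (bootstrap V E r A (Suc i))"
        by (rule psubset_card_mono[OF fin])
      then show ?case using Suc.IH by linarith
    qed simp
    moreover have "card (bootstrap V E r A (Suc (card V))) \<le> card V"
      by (rule card_mono[OF assms(1) bootstrap_subset[OF assms(2)]])
    ultimately show False by (meson not_less_eq_eq)
  qed
  then show ?thesis using that by blast
qed

text \<open>The stage at which the process stops is itself closed under the infection rule.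
  Percolation can thus be proved by showing that a closed superset of \<open>A\<close> is
  everything, without tracking time steps.\<close>

lemma percolates_if_closed_sets_full:
  assumes "finite V" "A \<subseteq> V"
    and full: "\<And>B. A \<subseteq> B \<Longrightarrow> B \<subseteq> V \<Longrightarrow>
      (\<And>v. v \<in> V \<Longrightarrow> card (neighborhood V E v \<inter> B) \<ge> r \<Longrightarrow> v \<in> B) \<Longrightarrow> B = V"
  shows "percolates V E r A"
proof -
  obtain i where i: "bootstrap V E r A (Suc i) = bootstrap V E r A i"
    using bootstrap_eventually_closed[OF assms(1,2)] .
  have "bootstrap V E r A i = V"
  proof (rule full)
    show "A \<subseteq> bootstrap V E r A i" using bootstrap_mono[of 0 i V E r A] by simp
    show "bootstrap V E r A i \<subseteq> V" by (rule bootstrap_subset[OF assms(2)])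
    show "v \<in> bootstrap V E r A i"
      if "v \<in> V" "card (neighborhood V E v \<inter> bootstrap V E r A i) \<ge> r" for v
      using that i by auto
  qed
  then show ?thesis unfolding percolates_def by blast
qed

text \<open>Without such a vertex the process never moves, so percolation forces
  \<open>A = V\<close>; in that case \<open>u\<close>, having at least \<open>r\<close> neighbours,
  is such a vertex itself.\<close>

lemma percolates_imp_ex_active:
  assumes "percolates V E r A" "u \<in> V" "card (neighborhood V E u) \<ge> r"
  shows "\<exists>v\<in>V. card (neighborhood V E v \<inter> A) \<ge> r"
proof (rule ccontr)
  assume none: "\<not> ?thesis"
  have "bootstrap V E r A i = A" for i
    by (induction i) (use none in auto)
  then have "A = V" using assms(1) unfolding percolates_def by simp
  then have "neighborhood V E u \<inter> A = neighborhood V E u" unfolding neighborhood_def by auto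
  then show False using none assms by auto
qed

section \<open>Random subsets\<close>

abbreviation random_set :: "'a set \<Rightarrow> real \<Rightarrow> ('a \<Rightarrow> bool) pmf" where
  "random_set V p \<equiv> Pi_pmf V False (\<lambda>_. bernoulli_pmf p)"

lemma prob_subset_random_set:
  assumes "finite V" "U \<subseteq> V" "0 \<le> p" "p \<le> 1"
  shows "measure_pmf.prob (random_set V p) {f. \<forall>u\<in>U. f u} = p ^ card U"
proof -
  \<comment> \<open>As a product event with a trivial factor off \<open>U\<close>, the probability
    factorises over the coordinates.\<close>
  have "{f. \<forall>u\<in>U. f u} = Pi V (\<lambda>u. if u \<in> U then {True} else UNIV)"
    using assms(2) by (auto simp: Pi_def)
  then have "measure_pmf.prob (random_set V p) {f. \<forall>u\<in>U. f u}
      = (\<Prod>u\<in>V. measure_pmf.prob (bernoulli_pmf p) (if u \<in> U then {True} else UNIV))"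
    by (simp add: measure_Pi_pmf_Pi[OF assms(1)])
  also have "\<dots> = (\<Prod>u\<in>V. if u \<in> U then p else 1)"
    using assms(3,4) by (intro prod.cong) (auto simp: measure_pmf_single)
  also have "\<dots> = (\<Prod>u\<in>U. p)"
    using assms(1,2) by (simp add: prod.If_cases Int_absorb1)
  finally show ?thesis by simp
qed

text \<open>Finite support makes every real random variable on this space integrable.\<close>

lemma finite_set_random_set: "finite V \<Longrightarrow> finite (set_pmf (random_set V p))"
  by (rule finite_subset[OF set_Pi_pmf_subset'[where dflt = False]]) (auto intro: finite_PiE_dflt)

text \<open>Second moment method: two distinct sets \<open>U i\<close>, \<open>U j\<close> that intersect cover at least \<open>r + 1\<close>
  points, and disjoint ones contribute exactly the square of the mean.\<close>

lemma prob_no_configuration_le: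
  fixes U :: "'i \<Rightarrow> 'a set"
  assumes "finite V" "finite I" "I \<noteq> {}" "0 < p" "p \<le> 1"
    and U: "\<And>i. i \<in> I \<Longrightarrow> U i \<subseteq> V \<and> card (U i) = r" and inj: "inj_on U I"
    and M: "\<And>i. i \<in> I \<Longrightarrow> card {j \<in> I. U i \<inter> U j \<noteq> {}} \<le> M"
  shows "measure_pmf.prob (random_set V p) {f. \<not> (\<exists>i\<in>I. \<forall>u\<in>U i. f u)}
      \<le> (1 + real M * p) / (real (card I) * p ^ r)"
proof -
  define P where "P = measure_pmf (random_set V p)"
  interpret prob_space P unfolding P_def by (rule measure_pmf.prob_space_axioms)
  define S where "S i = {f. \<forall>u\<in>U i. f u}" for i
  define X :: "('a \<Rightarrow> bool) \<Rightarrow> real" where "X f = (\<Sum>i\<in>I. indicator (S i) f)" for f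
  define \<mu> where "\<mu> = real (card I) * p ^ r"
  have \<mu>: "\<mu> > 0" unfolding \<mu>_def using assms(2-4) by (simp add: card_gt_0_iff)
  have integrable: "integrable P g" for g :: "('a \<Rightarrow> bool) \<Rightarrow> real"
    unfolding P_def using finite_set_random_set[OF assms(1)] by (rule integrable_measure_pmf_finite)
  have finU: "finite (U i)" if "i \<in> I" for i using U[OF that] assms(1) finite_subset by blast
  have prob_eq: "prob (S i) = p ^ r" if "i \<in> I" for i
    unfolding P_def S_def using U[OF that] prob_subset_random_set assms by fastforce
  have prob_Int: "prob (S i \<inter> S j) = p ^ card (U i \<union> U j)" if "i \<in> I" "j \<in> I" for i j
  proof -
    have "S i \<inter> S j = {f. \<forall>u\<in>U i \<union> U j. f u}" by (auto simp: S_def)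
    then show ?thesis unfolding P_def using U that prob_subset_random_set[of V "U i \<union> U j"] assms
      by auto
  qed
  have mean: "expectation X = \<mu>"
    unfolding X_def \<mu>_def using integrable
    by (subst Bochner_Integration.integral_sum) (auto simp: P_def prob_eq[unfolded P_def])
  \<comment> \<open>The three summands cover equal, disjoint and overlapping pairs. Adding them
    instead of distinguishing cases lets the double sum be evaluated term by term.\<close>
  have pair: "prob (S i \<inter> S j) \<le> (p ^ r)\<^sup>2 + (if i = j then p ^ r else 0)
      + (if U i \<inter> U j \<noteq> {} then p ^ Suc r else 0)" if ij: "i \<in> I" "j \<in> I" for i j
  proof -
    consider "i = j" | "U i \<inter> U j = {}" | "i \<noteq> j" "U i \<inter> U j \<noteq> {}" by blast
    then show ?thesis
    proof cases
      case 1
      then show ?thesis using prob_eq[OF ij(1)] assms(4) by simp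
    next
      case 2
      then have "card (U i \<union> U j) = r + r" using U ij finU by (simp add: card_Un_disjoint)
      then have "prob (S i \<inter> S j) = (p ^ r)\<^sup>2"
        using prob_Int[OF ij] by (simp add: power2_eq_square power_add)
      then show ?thesis using assms(4) by simp
    next
      case 3
      then have "U i \<noteq> U j" using inj ij by (auto dest: inj_onD)
      \<comment> \<open>Distinct sets of equal size \<open>r\<close> cannot contain one another, so
        the union has at least \<open>r + 1\<close> points.\<close>
      then have "U i \<subset> U i \<union> U j" using U ij finU card_subset_eq[of "U i" "U j"]
          card_subset_eq[of "U j" "U i"] by auto
      then have "card (U i \<union> U j) \<ge> Suc r"
        using psubset_card_mono[of "U i \<union> U j" "U i"] U ij finU by auto
      then have "prob (S i \<inter> S j) \<le> p ^ Suc r"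
        using prob_Int[OF ij] assms(4,5) power_decreasing[of "Suc r" _ p] by simp
      then show ?thesis using 3 add_increasing[of "(p ^ r)\<^sup>2"] by simp
    qed
  qed
  have "expectation (\<lambda>f. (X f)\<^sup>2) = (\<Sum>i\<in>I. \<Sum>j\<in>I. prob (S i \<inter> S j))"
  proof -
    have "(X f)\<^sup>2 = (\<Sum>i\<in>I. \<Sum>j\<in>I. indicator (S i \<inter> S j) f)" for f
      unfolding X_def power2_eq_square sum_product by (simp add: indicator_inter_arith)
    then show ?thesis using integrable
      by (simp add: Bochner_Integration.integral_sum P_def)
  qed
  also have "\<dots> \<le> (\<Sum>i\<in>I. \<Sum>j\<in>I. (p ^ r)\<^sup>2 + (if i = j then p ^ r else 0)
      + (if U i \<inter> U j \<noteq> {} then p ^ Suc r else 0))"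
    by (intro sum_mono pair)
  also have "\<dots> = (\<Sum>i\<in>I. real (card I) * (p ^ r)\<^sup>2 + p ^ r
      + real (card {j \<in> I. U i \<inter> U j \<noteq> {}}) * p ^ Suc r)"
    using assms(2) by (intro sum.cong) (simp_all add: sum.distrib sum.If_cases Int_def)
  also have "\<dots> \<le> (\<Sum>i\<in>I. real (card I) * (p ^ r)\<^sup>2 + p ^ r + real M * p ^ Suc r)"
    using M assms(4) by (intro sum_mono add_left_mono mult_right_mono) auto
  also have "\<dots> = \<mu>\<^sup>2 + (1 + real M * p) * \<mu>"
    by (simp add: \<mu>_def power2_eq_square algebra_simps)
  finally have "variance X \<le> (1 + real M * p) * \<mu>"
    using variance_eq[OF integrable integrable, of X] mean by simp
  \<comment> \<open>If no configuration is present then \<open>X f = 0\<close>, a deviation of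
    exactly \<open>\<mu>\<close> from the mean, so Chebyshev's inequality applies.\<close>
  have "prob {f. \<not> (\<exists>i\<in>I. f \<in> S i)} \<le> prob {f \<in> space P. \<mu> \<le> \<bar>X f - expectation X\<bar>}"
    unfolding mean using \<mu> by (intro finite_measure_mono) (auto simp: P_def X_def)
  also have "\<dots> \<le> variance X / \<mu>\<^sup>2"
    using integrable \<mu> by (intro Chebyshev_inequality) (auto simp: P_def)
  also have "\<dots> \<le> (1 + real M * p) * \<mu> / \<mu>\<^sup>2"
    using \<open>variance X \<le> _\<close> by (intro divide_right_mono) auto
  also have "\<dots> = (1 + real M * p) / \<mu>" using \<mu> by (simp add: power2_eq_square)
  finally show ?thesis unfolding P_def S_def \<mu>_def by simp
qed

text \<open>Union bound over a vertex and an \<open>r\<close>-subset of its neighbourhood: there are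
  at most \<open>D ^ r\<close> such subsets, each fully infected with probability
  \<open>p ^ r\<close>.\<close>

lemma prob_ex_active_le:
  assumes "finite V" "0 \<le> p" "p \<le> 1"
    and D: "\<And>v. v \<in> V \<Longrightarrow> card (neighborhood V E v) \<le> D"
  shows "measure_pmf.prob (random_set V p)
      {f. \<exists>v\<in>V. card (neighborhood V E v \<inter> {v \<in> V. f v}) \<ge> r}
    \<le> real (card V) * real D ^ r * p ^ r"
proof -
  define T where "T v = {U. U \<subseteq> neighborhood V E v \<and> card U = r}" for v
  have nb: "neighborhood V E v \<subseteq> V" for v by (auto simp: neighborhood_def)
  have finN: "finite (neighborhood V E v)" for v using nb assms(1) finite_subset by blast
  then have finT: "finite (T v)" for v
    unfolding T_def by (rule finite_subset[rotated, OF finite_Pow_iff[THEN iffD2]]) auto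
  have "card (T v) \<le> D ^ r" if "v \<in> V" for v
  proof -
    have "card (T v) = card (neighborhood V E v) choose r"
      unfolding T_def by (rule n_subsets[OF finN])
    also have "\<dots> \<le> card (neighborhood V E v) ^ r"
      by (cases "r \<le> card (neighborhood V E v)") (simp_all add: binomial_le_pow binomial_eq_0)
    also have "\<dots> \<le> D ^ r" using D[OF that] by (rule power_mono) simp
    finally show ?thesis .
  qed
  then have cT: "real (card (T v)) \<le> real D ^ r" if "v \<in> V" for v
    using that by (metis of_nat_le_iff of_nat_power)
  have "measure_pmf.prob (random_set V p)
      {f. \<exists>v\<in>V. card (neighborhood V E v \<inter> {v \<in> V. f v}) \<ge> r}
    \<le> measure_pmf.prob (random_set V p) (\<Union>v\<in>V. \<Union>U\<in>T v. {f. \<forall>u\<in>U. f u})"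
  proof (intro measure_pmf.finite_measure_mono subsetI)
    fix f assume "f \<in> {f. \<exists>v\<in>V. card (neighborhood V E v \<inter> {v \<in> V. f v}) \<ge> r}"
    then obtain v where v: "v \<in> V" "card (neighborhood V E v \<inter> {v \<in> V. f v}) \<ge> r" by blast
    obtain U where "U \<subseteq> neighborhood V E v \<inter> {v \<in> V. f v}" "card U = r"
      using obtain_subset_with_card_n[OF v(2)] by metis
    then show "f \<in> (\<Union>v\<in>V. \<Union>U\<in>T v. {f. \<forall>u\<in>U. f u})" using v(1) by (auto simp: T_def)
  qed simp
  also have "\<dots> \<le> (\<Sum>v\<in>V. measure_pmf.prob (random_set V p) (\<Union>U\<in>T v. {f. \<forall>u\<in>U. f u}))"
    using assms(1) by (intro measure_pmf.finite_measure_subadditive_finite) auto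
  also have "\<dots> \<le> (\<Sum>v\<in>V. \<Sum>U\<in>T v. measure_pmf.prob (random_set V p) {f. \<forall>u\<in>U. f u})"
    using finT by (intro sum_mono measure_pmf.finite_measure_subadditive_finite) auto
  also have "\<dots> = (\<Sum>v\<in>V. \<Sum>U\<in>T v. p ^ r)"
    using nb assms by (intro sum.cong refl) (subst prob_subset_random_set, auto simp: T_def)
  also have "\<dots> \<le> (\<Sum>v\<in>V. real D ^ r * p ^ r)"
    using cT assms(2) by (intro sum_mono) (simp add: mult_right_mono)
  finally show ?thesis by simp
qed

section \<open>Coordinate flips in the cube\<close>

text \<open>Seen from a vertex \<open>v\<close>, the cube becomes the power set of
  \<open>{..<n}\<close> via \<open>flip v\<close>, and Hamming distance becomes the size of the
  symmetric difference. On naturals \<open>1 - v i\<close> swaps 0 and 1.\<close>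

definition flip :: "(nat \<Rightarrow> nat) \<Rightarrow> nat set \<Rightarrow> nat \<Rightarrow> nat" where
  "flip v S = (\<lambda>i. if i \<in> S then 1 - v i else v i)"

lemma finite_cube_verts [simp]: "finite (cube_verts n)"
  unfolding cube_verts_def by (intro finite_PiE) auto

lemma card_cube_verts: "card (cube_verts n) = 2 ^ n"
  unfolding cube_verts_def by (simp add: card_PiE numeral_2_eq_2)

lemma cube_verts_cases: "v \<in> cube_verts n \<Longrightarrow> i < n \<Longrightarrow> v i = 0 \<or> v i = 1"
  unfolding cube_verts_def by auto

lemma flip_in_cube_verts:
  assumes "v \<in> cube_verts n" "S \<subseteq> {..<n}" shows "flip v S \<in> cube_verts n"
proof -
  have "flip v S i \<in> {0, 1}" if "i < n" for i
    using cube_verts_cases[OF assms(1) that] by (auto simp: flip_def)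
  \<comment> \<open>\<open>cube_verts\<close> consists of extensional functions, so the value
    \<open>undefined\<close> off \<open>{..<n}\<close> must survive the flip.\<close>
  moreover have "flip v S i = undefined" if "i \<notin> {..<n}" for i
  proof -
    have "i \<notin> S" using that assms(2) by blast
    then show ?thesis
      using PiE_arb[OF assms(1)[unfolded cube_verts_def] that] by (simp add: flip_def)
  qed
  ultimately show ?thesis unfolding cube_verts_def by (intro PiE_I) simp_all
qed

lemma flip_eq_iff:
  assumes "v \<in> cube_verts n" "i < n" shows "flip v S i = flip v T i \<longleftrightarrow> (i \<in> S \<longleftrightarrow> i \<in> T)"
  using cube_verts_cases[OF assms]
  by (elim disjE; cases "i \<in> S"; cases "i \<in> T") (simp_all add: flip_def)

lemma inj_on_flip: "v \<in> cube_verts n \<Longrightarrow> inj_on (flip v) (Pow {..<n})"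
proof (rule inj_onI)
  fix S T assume "v \<in> cube_verts n" "S \<in> Pow {..<n}" "T \<in> Pow {..<n}" "flip v S = flip v T"
  then have "i \<in> S \<longleftrightarrow> i \<in> T" if "i < n" for i using flip_eq_iff that by metis
  with \<open>S \<in> _\<close> \<open>T \<in> _\<close> show "S = T" by auto
qed

lemma flip_flip:
  assumes "v \<in> cube_verts n" "S \<subseteq> {..<n}" shows "flip (flip v S) S = v"
proof
  fix i show "flip (flip v S) S i = v i"
    using cube_verts_cases[OF assms(1), of i] assms(2) by (cases "i < n") (auto simp: flip_def)
qed

lemma hamming_dist_flip:
  assumes "v \<in> cube_verts n" "S \<subseteq> {..<n}" "T \<subseteq> {..<n}"
  shows "hamming_dist n (flip v S) (flip v T) = card ((S - T) \<union> (T - S))"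
proof -
  have "{i \<in> {..<n}. flip v S i \<noteq> flip v T i} = (S - T) \<union> (T - S)"
    using flip_eq_iff[OF assms(1)] assms(2,3) by auto
  then show ?thesis by (simp add: hamming_dist_def)
qed

lemma ex_flip:
  assumes "v \<in> cube_verts n" "w \<in> cube_verts n"
  shows "w = flip v {i. i < n \<and> v i \<noteq> w i}"
proof
  fix i show "w i = flip v {i. i < n \<and> v i \<noteq> w i} i"
  proof (cases "i < n")
    case True
    show ?thesis
      using cube_verts_cases[OF assms(1) True] cube_verts_cases[OF assms(2) True] True
      by (auto simp: flip_def)
  next
    case False
    then have "i \<notin> {..<n}" by simp
    then show ?thesis
      using assms[unfolded cube_verts_def, THEN PiE_arb] False by (simp add: flip_def)
  qed
qed

text \<open>A neighbour is encoded by a list of \<open>k\<close> coordinates whose entries are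
  exactly those to flip; there are \<open>n ^ k\<close> such lists.\<close>

lemma card_neighborhood_cube_le:
  assumes v: "v \<in> cube_verts n"
  shows "card (neighborhood (cube_verts n) (cube_adj n k) v) \<le> n ^ k"
proof -
  define L where "L = {xs. set xs \<subseteq> {..<n} \<and> length xs = k}"
  have "neighborhood (cube_verts n) (cube_adj n k) v \<subseteq> (\<lambda>xs. flip v (set xs)) ` L"
  proof
    fix w assume "w \<in> neighborhood (cube_verts n) (cube_adj n k) v"
    then have w: "w \<in> cube_verts n" "cube_adj n k v w" by (auto simp: neighborhood_def)
    define T where "T = {i. i < n \<and> v i \<noteq> w i}"
    have T: "1 \<le> card T" "card T \<le> k" "T \<subseteq> {..<n}"
      using w(2) by (auto simp: T_def cube_adj_def hamming_dist_def)
    \<comment> \<open>Adjacent vertices differ somewhere; repeating one such coordinate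
      \<open>t\<close> pads a shorter list to length \<open>k\<close>.\<close>
    then obtain t where t: "t \<in> T" by (metis One_nat_def Suc_le_eq card_gt_0_iff ex_in_conv)
    obtain xs where xs: "set xs = T" "distinct xs"
      using T(3) finite_subset finite_distinct_list by blast
    have "xs @ replicate (k - card T) t \<in> L" "set (xs @ replicate (k - card T) t) = T"
      using xs t T distinct_card[OF xs(2)] by (auto simp: L_def set_replicate_conv_if)
    then show "w \<in> (\<lambda>xs. flip v (set xs)) ` L"
      using ex_flip[OF v w(1)] unfolding T_def[symmetric] by (metis (no_types, lifting) image_eqI)
  qed
  moreover have "finite L" "card L = n ^ k"
    unfolding L_def by (simp_all add: finite_lists_length_eq card_lists_length_eq)
  ultimately show ?thesis using surj_card_le by metis
qed

text \<open>The \<open>n\<close> single flips are neighbours. This supplies the degree hypothesis of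
  \<open>percolates_imp_ex_active\<close>.\<close>

lemma card_neighborhood_cube_ge:
  assumes v: "v \<in> cube_verts n" and "k \<ge> 1"
  shows "card (neighborhood (cube_verts n) (cube_adj n k) v) \<ge> n"
proof -
  have "(\<lambda>i. flip v {i}) ` {..<n} \<subseteq> neighborhood (cube_verts n) (cube_adj n k) v"
  proof safe
    fix i assume i: "i < n"
    have "hamming_dist n (flip v {}) (flip v {i}) = 1"
      using i hamming_dist_flip[OF v, of "{}" "{i}"] by simp
    moreover have "flip v {} = v" by (simp add: flip_def)
    ultimately show "flip v {i} \<in> neighborhood (cube_verts n) (cube_adj n k) v"
      using flip_in_cube_verts[OF v, of "{i}"] i assms(2)
      by (simp add: neighborhood_def cube_adj_def)
  qed
  moreover have "inj_on (\<lambda>i. flip v {i}) {..<n}"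
    using inj_on_flip[OF v] by (auto simp: inj_on_def)
  moreover have "finite (neighborhood (cube_verts n) (cube_adj n k) v)"
    by (simp add: neighborhood_def)
  ultimately show ?thesis by (metis card_image card_lessThan card_mono)
qed

section \<open>Percolating triples\<close>

lemma triple_percolates:
  assumes v: "v \<in> cube_verts n" and k: "k \<ge> 2"
    and S: "S1 \<subseteq> {..<n}" "S2 \<subseteq> {..<n}" "S3 \<subseteq> {..<n}"
    and card_S: "card S1 = k" "card S2 = k" "card S3 = k"
    and disj: "S1 \<inter> S2 = {}" "S1 \<inter> S3 = {}" "S2 \<inter> S3 = {}"
    and A: "A \<subseteq> cube_verts n" "flip v S1 \<in> A" "flip v S2 \<in> A" "flip v S3 \<in> A"
  shows "percolates (cube_verts n) (cube_adj n k) 3 A"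
proof (rule percolates_if_closed_sets_full)
  fix B
  assume AB: "A \<subseteq> B" and B: "B \<subseteq> cube_verts n"
    and closed: "\<And>w. w \<in> cube_verts n \<Longrightarrow>
      card (neighborhood (cube_verts n) (cube_adj n k) w \<inter> B) \<ge> 3 \<Longrightarrow> w \<in> B"
  \<comment> \<open>\<open>F\<close> is the closed set \<open>B\<close> seen from \<open>v\<close>.
    The next fact is the infection rule in these terms; it allows \<open>T\<close> to be one of the
    three infecting sets.\<close>
  define F where "F = {T. T \<subseteq> {..<n} \<and> flip v T \<in> B}"
  have infect: "T \<in> F"
    if T: "T \<subseteq> {..<n}" and XYZ: "X \<in> F" "Y \<in> F" "Z \<in> F" "X \<noteq> Y" "X \<noteq> Z" "Y \<noteq> Z"
      and d: "card ((T - X) \<union> (X - T)) \<le> k" "card ((T - Y) \<union> (Y - T)) \<le> k"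
        "card ((T - Z) \<union> (Z - T)) \<le> k" for T X Y Z
  proof (cases "T = X \<or> T = Y \<or> T = Z")
    case False
    have nb: "flip v W \<in> neighborhood (cube_verts n) (cube_adj n k) (flip v T) \<inter> B"
      if W: "W \<in> F" "T \<noteq> W" "card ((T - W) \<union> (W - T)) \<le> k" for W
    proof -
      have sub: "W \<subseteq> {..<n}" "flip v W \<in> B" using W by (auto simp: F_def)
      have "finite ((T - W) \<union> (W - T))" using T sub(1) finite_subset[of _ "{..<n}"] by auto
      then have "card ((T - W) \<union> (W - T)) \<ge> 1"
        using W(2) by (metis Diff_eq_empty_iff One_nat_def Suc_leI Un_empty card_gt_0_iff subset_antisym)
      then show ?thesis
        using W(3) sub B hamming_dist_flip[OF v T sub(1)] by (auto simp: neighborhood_def cube_adj_def)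
    qed
    have sub: "X \<in> Pow {..<n}" "Y \<in> Pow {..<n}" "Z \<in> Pow {..<n}" using XYZ by (auto simp: F_def)
    have "flip v X \<noteq> flip v Y" "flip v X \<noteq> flip v Z" "flip v Y \<noteq> flip v Z"
      using inj_onD[OF inj_on_flip[OF v]] sub XYZ by blast+
    then have "card {flip v X, flip v Y, flip v Z} = 3" by simp
    moreover have "{flip v X, flip v Y, flip v Z}
        \<subseteq> neighborhood (cube_verts n) (cube_adj n k) (flip v T) \<inter> B"
      using nb XYZ d False by blast
    moreover have "finite (neighborhood (cube_verts n) (cube_adj n k) (flip v T) \<inter> B)"
      by (simp add: neighborhood_def)
    ultimately have "card (neighborhood (cube_verts n) (cube_adj n k) (flip v T) \<inter> B) \<ge> 3"
      by (metis card_mono)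
    then show ?thesis using closed flip_in_cube_verts[OF v T] T by (simp add: F_def)
  qed (use XYZ in auto)
  have fin: "finite S1" "finite S2" "finite S3" using S by (auto intro: finite_subset)
  have SF: "S1 \<in> F" "S2 \<in> F" "S3 \<in> F" using A AB S by (auto simp: F_def)
  have ne: "S1 \<noteq> {}" "S2 \<noteq> {}" "S3 \<noteq> {}" using card_S k by auto
  have empty: "{} \<in> F"
    using infect[of "{}" S1 S2 S3] SF ne disj card_S by auto
  \<comment> \<open>Passing from \<open>S1\<close> to \<open>{a, b}\<close> removes the other
    \<open>k - 1\<close> elements and adds \<open>b\<close>, a distance of exactly \<open>k\<close>;
    the same holds for \<open>S2\<close>, and \<open>{}\<close> is at distance 2.\<close>
  have pair: "{a, b} \<in> F" if ab: "a \<in> S1" "b \<in> S2" for a b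
  proof (rule infect[of "{a, b}" "{}" S1 S2])
    have ne_ab: "a \<noteq> b" "a \<notin> S2" "b \<notin> S1" using ab disj by auto
    show "card (({a, b} - {}) \<union> ({} - {a, b})) \<le> k" using k ne_ab by simp
    have "({a, b} - S1) \<union> (S1 - {a, b}) = insert b (S1 - {a})" using ab ne_ab by auto
    then show "card (({a, b} - S1) \<union> (S1 - {a, b})) \<le> k"
      using ab ne_ab fin card_S k by simp
    have "({a, b} - S2) \<union> (S2 - {a, b}) = insert a (S2 - {b})" using ab ne_ab by auto
    then show "card (({a, b} - S2) \<union> (S2 - {a, b})) \<le> k"
      using ab ne_ab fin card_S k by simp
  qed (use ab S empty SF ne disj in auto)
  have two: "\<exists>a b. a \<in> W \<and> b \<in> W \<and> a \<noteq> b" if "card W = k" for W :: "nat set"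
    using that k by (metis One_nat_def card_le_Suc0_iff_eq card.infinite not_less_eq_eq numeral_2_eq_2
        order_trans zero_le)
  \<comment> \<open>\<open>{a}\<close> is at distance 1 from \<open>{}\<close>,
    \<open>{a, b}\<close> and \<open>{a, c}\<close>; two different elements \<open>b\<close>,
    \<open>c\<close> of \<open>S2\<close> exist because \<open>k \<ge> 2\<close>.\<close>
  have single_S1: "{a} \<in> F" if a: "a \<in> S1" for a
  proof -
    obtain b c where bc: "b \<in> S2" "c \<in> S2" "b \<noteq> c" using two[OF card_S(2)] by blast
    have "a \<noteq> b" "a \<noteq> c" using a bc disj by auto
    then have "card (({a} - {a, b}) \<union> ({a, b} - {a})) = 1" "card (({a} - {a, c}) \<union> ({a, c} - {a})) = 1"
      by (simp_all add: insert_Diff_if)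
    then show ?thesis
      using infect[of "{a}" "{}" "{a, b}" "{a, c}"] empty pair a bc S k \<open>a \<noteq> b\<close>
      by (auto simp: doubleton_eq_iff)
  qed
  obtain a a' where aa': "a \<in> S1" "a' \<in> S1" "a \<noteq> a'" using two[OF card_S(1)] by blast
  have card2: "card (({t} - {s}) \<union> ({s} - {t})) \<le> k" for s t :: nat
  proof -
    have "card (({t} - {s}) \<union> ({s} - {t})) \<le> card {s, t}" by (intro card_mono) auto
    also have "\<dots> \<le> k" using k card_insert_le_m1[of 2 "{t}" s] by simp
    finally show ?thesis .
  qed
  \<comment> \<open>Any two singletons are at distance at most 2, so \<open>{}\<close>,
    \<open>{a}\<close> and \<open>{a'}\<close> infect every \<open>{t}\<close>.\<close>
  have single: "{t} \<in> F" if "t < n" for t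
    using infect[of "{t}" "{}" "{a}" "{a'}"] empty single_S1 aa' card2 that k by auto
  \<comment> \<open>Induction on size: a set with two elements \<open>s\<close>, \<open>t\<close> is
    infected by removing \<open>s\<close>, \<open>t\<close> or both, at distances 1, 1 and
    2.\<close>
  have all: "T \<in> F" if "T \<subseteq> {..<n}" for T
    using that
  proof (induction "card T" arbitrary: T rule: less_induct)
    case less
    have finT: "finite T" using less.prems finite_subset by blast
    show ?case
    proof (cases "card T \<le> 1")
      case True
      then have "T = {} \<or> (\<exists>t. T = {t})"
        using finT by (metis One_nat_def card_0_eq card_1_singletonE le_Suc_eq le_zero_eq)
      then show ?thesis using empty single less.prems by auto
    next
      case False
      then obtain s t where st: "s \<in> T" "t \<in> T" "s \<noteq> t"
        using finT by (metis One_nat_def card_le_Suc0_iff_eq)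
      have "T - {s} \<in> F" "T - {t} \<in> F" "T - {s, t} \<in> F"
        using st finT less.prems by (auto intro!: less.hyps psubset_card_mono)
      moreover have "(T - (T - {s})) \<union> ((T - {s}) - T) = {s}" "(T - (T - {t})) \<union> ((T - {t}) - T) = {t}"
        "(T - (T - {s, t})) \<union> ((T - {s, t}) - T) = {s, t}"
        using st by auto
      moreover have "T - {s} \<noteq> T - {t}" "T - {s} \<noteq> T - {s, t}" "T - {t} \<noteq> T - {s, t}"
        using st by auto
      ultimately show ?thesis using infect[of T "T - {s}" "T - {t}" "T - {s, t}"] less.prems st k by simp
    qed
  qed
  show "B = cube_verts n"
  proof (intro equalityI B subsetI)
    fix w assume "w \<in> cube_verts n"
    then have "w = flip v {i. i < n \<and> v i \<noteq> w i}" by (rule ex_flip[OF v])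
    moreover have "{i. i < n \<and> v i \<noteq> w i} \<in> F" by (rule all) auto
    ultimately show "w \<in> B" by (simp add: F_def)
  qed
qed (use A in auto)

section \<open>Counting triples with one set in each third of the coordinates\<close>

definition block_subsets :: "nat \<Rightarrow> nat \<Rightarrow> nat \<Rightarrow> nat set set" where
  "block_subsets m k a = {S. S \<subseteq> {a * m..<Suc a * m} \<and> card S = k}"

lemma finite_block_subsets: "finite (block_subsets m k a)"
  unfolding block_subsets_def by (rule finite_subset[of _ "Pow {a * m..<Suc a * m}"]) auto

lemma card_block_subsets: "card (block_subsets m k a) = m choose k"
  unfolding block_subsets_def by (subst n_subsets) auto

lemma block_subsets_disjoint:
  assumes "S \<in> block_subsets m k a" "T \<in> block_subsets m k b" "a < b" shows "S \<inter> T = {}"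
proof -
  have "Suc a * m \<le> b * m" using assms(3) by (intro mult_le_mono1) simp
  then show ?thesis using assms by (fastforce simp: block_subsets_def)
qed

lemma block_subsets_le:
  assumes "S \<in> block_subsets m k a" "a < 3" "m = n div 3" shows "S \<subseteq> {..<n}"
proof -
  have "Suc a * m \<le> 3 * m" using assms(2) by (intro mult_le_mono1) simp
  then have "Suc a * m \<le> n" using assms(3) by linarith
  then show ?thesis using assms(1) by (fastforce simp: block_subsets_def)
qed

type_synonym pointed_triple = "(nat \<Rightarrow> nat) \<times> nat set \<times> nat set \<times> nat set"

text \<open>Using one block per set makes the three sets disjoint and fixes their order, so that
  different pointed triples give different vertex sets.\<close>

definition pointed_triples :: "nat \<Rightarrow> nat \<Rightarrow> pointed_triple set" where
  "pointed_triples n k = cube_verts n \<times> block_subsets (n div 3) k 0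
     \<times> block_subsets (n div 3) k 1 \<times> block_subsets (n div 3) k 2"

definition triple :: "pointed_triple \<Rightarrow> (nat \<Rightarrow> nat) set" where
  "triple = (\<lambda>(v, S1, S2, S3). {flip v S1, flip v S2, flip v S3})"

lemma finite_pointed_triples: "finite (pointed_triples n k)"
  unfolding pointed_triples_def by (simp add: finite_block_subsets)

lemma card_pointed_triples: "card (pointed_triples n k) = 2 ^ n * (n div 3 choose k) ^ 3"
  unfolding pointed_triples_def
  by (simp add: card_cartesian_product card_cube_verts card_block_subsets power3_eq_cube)

lemma pointed_tripleD:
  assumes "(v, S1, S2, S3) \<in> pointed_triples n k"
  shows "v \<in> cube_verts n" "S1 \<subseteq> {..<n}" "S2 \<subseteq> {..<n}" "S3 \<subseteq> {..<n}"
    "card S1 = k" "card S2 = k" "card S3 = k"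
    "S1 \<inter> S2 = {}" "S1 \<inter> S3 = {}" "S2 \<inter> S3 = {}"
  using assms block_subsets_disjoint[of S1 "n div 3" k 0 S2 1]
    block_subsets_disjoint[of S1 "n div 3" k 0 S3 2] block_subsets_disjoint[of S2 "n div 3" k 1 S3 2]
    block_subsets_le[of S1 "n div 3" k 0 n] block_subsets_le[of S2 "n div 3" k 1 n]
    block_subsets_le[of S3 "n div 3" k 2 n]
  unfolding pointed_triples_def by (simp_all add: block_subsets_def)

lemma flips_distinct:
  assumes "(v, S1, S2, S3) \<in> pointed_triples n k" "k \<ge> 1"
  shows "flip v S1 \<noteq> flip v S2" "flip v S1 \<noteq> flip v S3" "flip v S2 \<noteq> flip v S3"
proof -
  note D = pointed_tripleD[OF assms(1)]
  have "S1 \<noteq> {}" "S2 \<noteq> {}" "S3 \<noteq> {}" using D assms(2) by auto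
  then have "S1 \<noteq> S2" "S1 \<noteq> S3" "S2 \<noteq> S3" using D by auto
  then show "flip v S1 \<noteq> flip v S2" "flip v S1 \<noteq> flip v S3" "flip v S2 \<noteq> flip v S3"
    using inj_on_flip[OF D(1)] D(2-4) by (auto dest: inj_onD)
qed

text \<open>The center is the coordinatewise majority of the triple.\<close>

lemma center_eq_majority:
  assumes "(v, S1, S2, S3) \<in> pointed_triples n k" "k \<ge> 1" "t < n"
  shows "v t = 1 \<longleftrightarrow> (\<exists>w\<in>triple (v, S1, S2, S3). \<exists>w'\<in>triple (v, S1, S2, S3).
    w \<noteq> w' \<and> w t = 1 \<and> w' t = 1)"
proof -
  note D = pointed_tripleD[OF assms(1)] and ne = flips_distinct[OF assms(1,2)]
  have flip_1: "flip v S t = 1 \<longleftrightarrow> (v t = 1) \<noteq> (t \<in> S)" for S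
    using cube_verts_cases[OF D(1) assms(3)] by (cases "t \<in> S") (auto simp: flip_def)
  \<comment> \<open>By disjointness at most one of the three vertices differs from \<open>v\<close>
    at \<open>t\<close>, so two of them agree with \<open>v\<close> there.\<close>
  have "\<not> (t \<in> S1 \<and> t \<in> S2)" "\<not> (t \<in> S1 \<and> t \<in> S3)" "\<not> (t \<in> S2 \<and> t \<in> S3)"
    using D by auto
  then show ?thesis
    unfolding triple_def prod.case bex_simps using ne ne[symmetric] flip_1[of S1] flip_1[of S2] flip_1[of S3]
    by (cases "v t = 1"; cases "t \<in> S1"; cases "t \<in> S2"; cases "t \<in> S3") simp_all
qed

text \<open>The majority recovers the center \<open>v\<close>, injectivity of \<open>flip v\<close>
  then recovers \<open>{S1, S2, S3}\<close>, and the blocks recover which set is which, since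
  nonempty sets from different blocks differ.\<close>

lemma inj_on_triple:
  assumes "k \<ge> 1" shows "inj_on triple (pointed_triples n k)"
proof (rule inj_onI)
  fix i j assume ij: "i \<in> pointed_triples n k" "j \<in> pointed_triples n k" "triple i = triple j"
  obtain v S1 S2 S3 where i: "i = (v, S1, S2, S3)" by (metis prod_cases4)
  obtain w T1 T2 T3 where j: "j = (w, T1, T2, T3)" by (metis prod_cases4)
  note Di = pointed_tripleD[OF ij(1)[unfolded i]] and Dj = pointed_tripleD[OF ij(2)[unfolded j]]
  have "v t = 1 \<longleftrightarrow> w t = 1" if "t < n" for t
    using center_eq_majority[OF ij(1)[unfolded i] assms that]
      center_eq_majority[OF ij(2)[unfolded j] assms that] ij(3)[unfolded i j] by simp
  then have "v t = w t" if "t < n" for t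
    using that cube_verts_cases[OF Di(1) that] cube_verts_cases[OF Dj(1) that] by force
  then have vw: "v = w"
    using Di(1) Dj(1) unfolding cube_verts_def by (intro PiE_ext) auto
  have "flip v ` {S1, S2, S3} = flip v ` {T1, T2, T3}"
    using ij(3) unfolding i j triple_def vw by simp
  then have sets: "{S1, S2, S3} = {T1, T2, T3}"
    using inj_on_image_eq_iff[OF inj_on_flip[OF Di(1)], of "{S1, S2, S3}" "{T1, T2, T3}"] Di Dj by simp
  have Bi: "S1 \<in> block_subsets (n div 3) k 0" "S2 \<in> block_subsets (n div 3) k 1"
      "S3 \<in> block_subsets (n div 3) k 2"
    and Bj: "T1 \<in> block_subsets (n div 3) k 0" "T2 \<in> block_subsets (n div 3) k 1"
      "T3 \<in> block_subsets (n div 3) k 2"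
    using ij(1,2) unfolding i j pointed_triples_def by auto
  have "S1 \<inter> T2 = {}" "S1 \<inter> T3 = {}" "T1 \<inter> S2 = {}" "S2 \<inter> T3 = {}" "T1 \<inter> S3 = {}" "T2 \<inter> S3 = {}"
    by (rule block_subsets_disjoint[OF Bi(1) Bj(2)] block_subsets_disjoint[OF Bi(1) Bj(3)]
        block_subsets_disjoint[OF Bj(1) Bi(2)] block_subsets_disjoint[OF Bi(2) Bj(3)]
        block_subsets_disjoint[OF Bj(1) Bi(3)] block_subsets_disjoint[OF Bj(2) Bi(3)]; simp)+
  moreover have "S1 \<noteq> {}" "S2 \<noteq> {}" "S3 \<noteq> {}" using Di assms by auto
  ultimately have "S1 \<notin> {T2, T3}" "S2 \<notin> {T1, T3}" "S3 \<notin> {T1, T2}" by blast+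
  moreover have "S1 \<in> {T1, T2, T3}" "S2 \<in> {T1, T2, T3}" "S3 \<in> {T1, T2, T3}"
    unfolding sets[symmetric] by simp_all
  ultimately have "S1 = T1" "S2 = T2" "S3 = T3" by simp_all
  then show "i = j" using vw i j by simp
qed

text \<open>A triple meeting \<open>triple i\<close> is determined by a common vertex (at most 3
  choices), its position in the triple (3 choices) and the three sets: flipping the common vertex
  back gives the center.\<close>

lemma card_intersecting_triples_le:
  assumes i: "i \<in> pointed_triples n k"
  shows "card {j \<in> pointed_triples n k. triple i \<inter> triple j \<noteq> {}} \<le> 9 * (n div 3 choose k) ^ 3"
proof -
  let ?B = "block_subsets (n div 3) k"
  define D where "D = triple i \<times> {..<3::nat} \<times> ?B 0 \<times> ?B 1 \<times> ?B 2"
  \<comment> \<open>\<open>g\<close> rebuilds the pointed triple from the common vertex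
    \<open>u\<close>, its position \<open>a\<close> and the three sets.\<close>
  define g where "g = (\<lambda>(u, a, S1, S2, S3).
    (flip u (if a = (0::nat) then S1 else if a = 1 then S2 else S3), S1, S2, S3))"
  have ct: "finite (triple i)" "card (triple i) \<le> 3"
    unfolding triple_def by (auto split: prod.splits intro: order_trans[OF card_insert_le_m1] simp: card_insert_if)
  have finD: "finite D" unfolding D_def using ct by (simp add: finite_block_subsets)
  have "{j \<in> pointed_triples n k. triple i \<inter> triple j \<noteq> {}} \<subseteq> g ` D"
  proof
    fix j assume "j \<in> {j \<in> pointed_triples n k. triple i \<inter> triple j \<noteq> {}}"
    then obtain u where j: "j \<in> pointed_triples n k" and u: "u \<in> triple i" "u \<in> triple j" by blast
    obtain v S1 S2 S3 where j_eq: "j = (v, S1, S2, S3)" by (metis prod_cases4)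
    note Dj = pointed_tripleD[OF j[unfolded j_eq]]
    have bl: "S1 \<in> ?B 0" "S2 \<in> ?B 1" "S3 \<in> ?B 2" using j unfolding j_eq pointed_triples_def by auto
    consider "u = flip v S1" | "u = flip v S2" | "u = flip v S3"
      using u(2) unfolding j_eq triple_def by auto
    then show "j \<in> g ` D"
    proof cases
      case 1
      then have "j = g (u, 0, S1, S2, S3)" using flip_flip[OF Dj(1,2)] by (simp add: g_def j_eq)
      then show ?thesis using bl u by (auto simp: D_def)
    next
      case 2
      then have "j = g (u, 1, S1, S2, S3)" using flip_flip[OF Dj(1,3)] by (simp add: g_def j_eq)
      then show ?thesis using bl u by (auto simp: D_def)
    next
      case 3
      then have "j = g (u, 2, S1, S2, S3)" using flip_flip[OF Dj(1,4)] by (simp add: g_def j_eq)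
      then show ?thesis using bl u by (auto simp: D_def)
    qed
  qed
  then have "card {j \<in> pointed_triples n k. triple i \<inter> triple j \<noteq> {}} \<le> card D"
    using finD by (rule surj_card_le[rotated])
  also have "\<dots> = card (triple i) * (3 * (n div 3 choose k) ^ 3)"
    unfolding D_def by (simp add: card_cartesian_product card_block_subsets power3_eq_cube)
  also have "\<dots> \<le> 3 * (3 * (n div 3 choose k) ^ 3)" using ct(2) by (rule mult_le_mono1)
  finally show ?thesis by simp
qed

section \<open>The critical probability\<close>

text \<open>The first moment half, with degrees at most \<open>n ^ k\<close>. The bound
  \<open>n \<ge> 3\<close> guarantees a vertex with three neighbours.\<close>

lemma percolation_prob_le:
  assumes "n \<ge> 3" "k \<ge> 1" "0 \<le> p" "p \<le> 1"
  shows "percolation_prob (cube_verts n) (cube_adj n k) 3 p \<le> 2 ^ n * (real n ^ k * p) ^ 3"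
proof -
  have "cube_verts n \<noteq> {}" using card_cube_verts[of n] by auto
  then obtain u where u: "u \<in> cube_verts n" by blast
  have "percolation_prob (cube_verts n) (cube_adj n k) 3 p
    \<le> measure_pmf.prob (random_set (cube_verts n) p)
      {f. \<exists>v\<in>cube_verts n. card (neighborhood (cube_verts n) (cube_adj n k) v \<inter> {v \<in> cube_verts n. f v}) \<ge> 3}"
    unfolding percolation_prob_def
    using percolates_imp_ex_active[OF _ u] card_neighborhood_cube_ge[OF u assms(2)] assms(1)
    by (intro measure_pmf.finite_measure_mono) auto
  also have "\<dots> \<le> real (card (cube_verts n)) * real (n ^ k) ^ 3 * p ^ 3"
    by (intro prob_ex_active_le card_neighborhood_cube_le assms finite_cube_verts)
  finally show ?thesis by (simp add: card_cube_verts power_mult_distrib mult.assoc)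
qed

text \<open>The second moment half, with \<open>M = 9 * K ^ 3\<close> for
  \<open>K = n div 3 choose k\<close>. The first term is the inverse of the expected number of
  infected triples, the second comes from overlapping pairs.\<close>

lemma percolation_prob_ge:
  assumes "k \<ge> 2" "n div 3 \<ge> k" "0 < p" "p \<le> 1"
  shows "1 - percolation_prob (cube_verts n) (cube_adj n k) 3 p
    \<le> 1 / (2 ^ n * (real (n div 3 choose k) * p) ^ 3) + 9 / (2 ^ n * p\<^sup>2)"
proof -
  define K where "K = n div 3 choose k"
  have K: "K > 0" using assms(2) by (simp add: K_def)
  let ?P = "measure_pmf.prob (random_set (cube_verts n) p)"
  have "1 - percolation_prob (cube_verts n) (cube_adj n k) 3 p
      = ?P {f. \<not> percolates (cube_verts n) (cube_adj n k) 3 {v \<in> cube_verts n. f v}}"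
    unfolding percolation_prob_def
    by (subst measure_pmf.prob_compl[symmetric]) (auto intro!: arg_cong[where f = ?P])
  also have "\<dots> \<le> ?P {f. \<not> (\<exists>i\<in>pointed_triples n k. \<forall>u\<in>triple i. f u)}"
  proof (intro measure_pmf.finite_measure_mono subsetI CollectI notI)
    fix f assume f: "f \<in> {f. \<not> percolates (cube_verts n) (cube_adj n k) 3 {v \<in> cube_verts n. f v}}"
      and "\<exists>i\<in>pointed_triples n k. \<forall>u\<in>triple i. f u"
    then obtain v S1 S2 S3 where i: "(v, S1, S2, S3) \<in> pointed_triples n k"
      and all: "\<forall>u\<in>triple (v, S1, S2, S3). f u" by (metis prod_cases4)
    note D = pointed_tripleD[OF i]
    have "percolates (cube_verts n) (cube_adj n k) 3 {v \<in> cube_verts n. f v}"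
      by (rule triple_percolates[OF D(1) assms(1) D(2-10)])
        (use all flip_in_cube_verts[OF D(1)] D(2-4) in \<open>auto simp: triple_def\<close>)
    then show False using f by simp
  qed simp
  also have "\<dots> \<le> (1 + real (9 * K ^ 3) * p) / (real (card (pointed_triples n k)) * p ^ 3)"
  proof (rule prob_no_configuration_le)
    show "triple i \<subseteq> cube_verts n \<and> card (triple i) = 3" if i: "i \<in> pointed_triples n k" for i
    proof -
      obtain v S1 S2 S3 where i_eq: "i = (v, S1, S2, S3)" by (metis prod_cases4)
      show ?thesis
        using pointed_tripleD[OF i[unfolded i_eq]] flips_distinct[OF i[unfolded i_eq]] assms(1)
          flip_in_cube_verts unfolding i_eq triple_def by auto
    qed
    show "card {j \<in> pointed_triples n k. triple i \<inter> triple j \<noteq> {}} \<le> 9 * K ^ 3"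
      if "i \<in> pointed_triples n k" for i
      unfolding K_def by (rule card_intersecting_triples_le[OF that])
    have "card (pointed_triples n k) \<noteq> 0" using K by (simp add: card_pointed_triples K_def)
    then show "pointed_triples n k \<noteq> {}" by auto
  qed (use assms finite_pointed_triples inj_on_triple in auto)
  also have "\<dots> = (1 + 9 * real K ^ 3 * p) / (2 ^ n * real K ^ 3 * p ^ 3)"
    by (simp add: card_pointed_triples K_def)
  also have "\<dots> = 1 / (2 ^ n * (real K * p) ^ 3) + 9 / (2 ^ n * p\<^sup>2)"
    using K assms(3) by (simp add: field_simps power2_eq_square power3_eq_cube)
  finally show ?thesis unfolding K_def .
qed

lemma powr_third_cubed: "(2 powr - (real n / 3)) ^ 3 = 1 / 2 ^ n"
proof -
  have "(2 powr - (real n / 3)) ^ 3 = 2 powr (- (real n / 3) * real 3)"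
    by (simp add: powr_powr powr_realpow[symmetric])
  also have "\<dots> = 1 / 2 ^ n" by (simp add: powr_minus_divide powr_realpow)
  finally show ?thesis .
qed

theorem theorem3p5:
  fixes k :: nat and \<omega> :: "nat \<Rightarrow> real"
  assumes "k \<ge> 2"
    and "filterlim \<omega> at_top sequentially"
  shows "\<forall>\<^sub>F n in sequentially.
           1 / \<omega> n * 2 powr (- real n / 3) * real n powr (- real k)
             \<le> critical_prob (cube_verts n) (cube_adj n k) 3
         \<and> critical_prob (cube_verts n) (cube_adj n k) 3
             \<le> \<omega> n * 2 powr (- real n / 3) * real n powr (- real k)"
proof -
  \<comment> \<open>chosen so that the expected number of infected triples is at least \<open>8\<close>\<close>
  define C where "C = 2 * (4 * real k) ^ k"
  have C: "C > 0" using assms(1) by (simp add: C_def)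
  \<comment> \<open>The bound 2 serves the lower estimate, the bound \<open>C\<close> the upper
    one.\<close>
  have "\<forall>\<^sub>F n in sequentially. \<omega> n \<ge> max 2 C"
    using assms(2) unfolding filterlim_at_top by blast
  \<comment> \<open>This gives \<open>n div 3 \<ge> k\<close>, and \<open>n \<ge> 24\<close>, enough
    for \<open>n / 4 \<le> n div 3\<close>.\<close>
  moreover have "\<forall>\<^sub>F n in sequentially. n \<ge> 12 * k" by (rule eventually_ge_at_top)
  \<comment> \<open>The left side is of order \<open>2 powr (n / 3)\<close> times a power of
    \<open>n\<close>. The constant 36 makes the overlap term \<open>9 / (2 ^ n * p\<^sup>2)\<close>
    at most 1/4.\<close>
  moreover have "\<forall>\<^sub>F n in sequentially.
      2 ^ n * (C * 2 powr (- real n / 3) * real n powr (- real k))\<^sup>2 \<ge> 36"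
  proof -
    have "2 ^ n * (C * 2 powr (- real n / 3) * real n powr (- real k))\<^sup>2
        = C\<^sup>2 * 2 powr (real n / 3) * real n powr (- (real k + real k))" for n :: nat
    proof -
      have "2 ^ n * (C * 2 powr (- real n / 3) * real n powr (- real k))\<^sup>2
          = C\<^sup>2 * (2 powr real n * 2 powr (- real n / 3) * 2 powr (- real n / 3))
            * (real n powr (- real k) * real n powr (- real k))"
        by (simp add: power2_eq_square powr_realpow)
      also have "\<dots> = C\<^sup>2 * 2 powr (real n + - real n / 3 + - real n / 3)
            * real n powr (- real k + - real k)"
        by (simp only: powr_add)
      also have "real n + - real n / 3 + - real n / 3 = real n / 3" by simp
      finally show ?thesis by simp
    qed
    moreover have "filterlim (\<lambda>n::nat. c * 2 powr (real n / 3) * real n powr (- d)) at_top sequentially"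
      if "c > 0" for c d :: real
      using that by real_asymp
    ultimately have "filterlim
        (\<lambda>n. 2 ^ n * (C * 2 powr (- real n / 3) * real n powr (- real k))\<^sup>2) at_top sequentially"
      using C by simp
    then show ?thesis unfolding filterlim_at_top by blast
  qed
  ultimately show ?thesis
  proof eventually_elim
    case (elim n)
    define e where "e = 2 powr (- real n / 3) * real n powr (- real k)"
    have n: "n \<ge> 24" "n div 3 \<ge> k" using elim(2) assms(1) by linarith+
    have w: "\<omega> n \<ge> 2" "\<omega> n \<ge> C" using elim(1) by auto
    have npowr: "real n powr (- real k) = 1 / real n ^ k"
      using n by (simp add: powr_minus_divide powr_realpow)
    \<comment> \<open>At the scale \<open>e\<close> the union bound of
      \<open>percolation_prob_le\<close> equals 1, so a factor in \<open>p\<close> enters that bound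
      as its cube.\<close>
    have e_cubed: "2 ^ n * (real n ^ k * e) ^ 3 = 1"
      using n by (simp add: e_def npowr power_mult_distrib powr_third_cubed power_divide)
    have "2 powr (- real n / 3) \<le> 1" using powr_mono[of "- real n / 3" 0 2] by simp
    moreover have "real n powr (- real k) \<le> 1" using n npowr by (simp add: divide_le_eq)
    ultimately have e: "0 < e" "e \<le> 1" using n unfolding e_def by (auto intro: mult_le_one)
    \<comment> \<open>One member of \<open>Q\<close> bounds its supremum from below; the upper bound
      has to be shown for every member.\<close>
    define Q where "Q = {p \<in> {0<..<1}. percolation_prob (cube_verts n) (cube_adj n k) 3 p \<le> 1 / 2}"
    have lower: "e / \<omega> n \<in> Q"
    proof -
      have "e / \<omega> n < 1" "0 < e / \<omega> n" using e w by (auto simp: field_simps)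
      moreover have "2 ^ n * (real n ^ k * (e / \<omega> n)) ^ 3 = 1 / \<omega> n ^ 3"
        using e_cubed by (simp add: power_divide power_mult_distrib)
      moreover have "1 / \<omega> n ^ 3 \<le> 1 / 2"
        using w power_mono[of 2 "\<omega> n" 3] by (simp add: divide_simps)
      ultimately show ?thesis
        using percolation_prob_le[of n k "e / \<omega> n"] n assms(1) by (simp add: Q_def)
    qed
    \<comment> \<open>A larger \<open>p\<close> would exceed \<open>C * e\<close>, and the failure
      probability would be at most 1/8 + 1/4, whereas membership in \<open>Q\<close> makes it at
      least 1/2.\<close>
    have upper: "p \<le> \<omega> n * e" if "p \<in> Q" for p
    proof (rule ccontr)
      assume "\<not> p \<le> \<omega> n * e"
      then have "p > \<omega> n * e" by simp
      moreover have "\<omega> n * e \<ge> C * e" using w e by (intro mult_right_mono) auto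
      ultimately have p: "p \<ge> C * e" "0 < p" "p \<le> 1" using that by (auto simp: Q_def)
      define K where "K = n div 3 choose k"
      have "real n / 4 \<le> real (n div 3)" using n by linarith
      then have "(real n / 4 / real k) ^ k \<le> (real (n div 3) / real k) ^ k"
        by (intro power_mono divide_right_mono) auto
      also have "\<dots> \<le> real K" unfolding K_def using binomial_ge_n_over_k_pow_k[OF n(2)] by simp
      finally have "(real n / (4 * real k)) ^ k \<le> real K" by simp
      then have "(real n / (4 * real k)) ^ k * (C * e) \<le> real K * p"
        using p C e by (intro mult_mono) auto
      \<comment> \<open>The factor \<open>(4 * real k) ^ k\<close> in \<open>C\<close> cancels the
        loss in the binomial estimate; the remaining 2 becomes 8 when cubed.\<close>
      moreover have "(real n / (4 * real k)) ^ k * (C * e) = 2 * (real n ^ k * e)"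
        using assms(1) by (simp add: C_def power_divide)
      ultimately have "(2 * (real n ^ k * e)) ^ 3 \<le> (real K * p) ^ 3"
        using e by (intro power_mono) auto
      then have "2 ^ n * (2 * (real n ^ k * e)) ^ 3 \<le> 2 ^ n * (real K * p) ^ 3"
        by (intro mult_left_mono) auto
      moreover have "2 ^ n * (2 * (real n ^ k * e)) ^ 3 = 8"
        using e_cubed by (simp add: power_mult_distrib)
      ultimately have "8 \<le> 2 ^ n * (real K * p) ^ 3" by linarith
      then have "1 / (2 ^ n * (real K * p) ^ 3) \<le> 1 / 8" by (simp add: divide_le_eq)
      moreover have "9 / (2 ^ n * p\<^sup>2) \<le> 1 / 4"
      proof -
        have "36 \<le> 2 ^ n * (C * e)\<^sup>2" using elim(3) by (simp add: e_def mult.assoc)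
        also have "\<dots> \<le> 2 ^ n * p\<^sup>2" using p C e by (intro mult_left_mono power_mono) auto
        finally have "36 \<le> 2 ^ n * p\<^sup>2" .
        then show ?thesis by (simp add: divide_le_eq)
      qed
      moreover have "percolation_prob (cube_verts n) (cube_adj n k) 3 p \<le> 1 / 2"
        using that by (simp add: Q_def)
      ultimately show False
        using percolation_prob_ge[OF assms(1) n(2) p(2,3)] unfolding K_def by linarith
    qed
    have "e / \<omega> n \<le> Sup Q" using lower upper by (intro cSup_upper bdd_aboveI) auto
    \<comment> \<open>Here \<open>lower\<close> also shows that \<open>Q\<close> is
      nonempty.\<close>
    moreover have "Sup Q \<le> \<omega> n * e" using lower upper by (intro cSup_least) auto
    ultimately show ?case
      unfolding critical_prob_def Q_def[symmetric] by (simp add: e_def mult.assoc)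
  qed
qed

end
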